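(* Let $N \geqslant 2$ and $0 \leqslant n_0 < \dots < n_{N-1}$ be integers with $(n_0,\dots,n_{N-1}) \neq (h,h+1,\dots,h+N-1)$ for any integer $h \geqslant 0$. Then there exists an integer $M > n_{N-1}$, such that any polynomial of the form $$z \mapsto c_{n_0} z^{n_0} + \dots + c_{n_{N-1}} z^{n_{N-1}} + c_M z^M,$$ with $c_{n_0},\dots,c_{n_{N-1}}$ positive and $c_M$ negative, cannot be entrywise positivity preserving on $\mathbb{P}^1_N(D(0,\rho))$ for any $\rho > 0$.
   Context: $D(0,\rho) := \{ z \in \mathbb{C} : |z| < \rho \}$. For $I \subset \mathbb{C}$, $\mathbb{P}^1_N(I)$ denotes the set of rank-one matrices $\mathbf{u}\mathbf{u}^*$ ($\mathbf{u}$ a complex column vector of length $N$) that are positive semidefinite Hermitian $N \times N$ with all entries in $I$. A function $f: I \to \mathbb{C}$ is entrywise positivity preserving on $\mathbb{P}^1_N(I)$ if $f[A] := (f(a_{jk}))$ is positive semidefinite for every $A=(a_{jk}) \in \mathbb{P}^1_N(I)$. *)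

theory Defs
  imports Jordan_Normal_Form.Schur_Decomposition Jordan_Normal_Form.DL_Rank
begin

definition hermitian_mat :: "complex mat \<Rightarrow> bool" where
  "hermitian_mat A \<longleftrightarrow> square_mat A \<and> mat_adjoint A = A"

text \<open>
  The order on \<^typ>\<open>complex\<close> is the one from \<^theory>\<open>HOL-Library.Complex_Order\<close>, where
  \<^prop>\<open>0 \<le> (z::complex)\<close> means that \<^term>\<open>z\<close> is real and nonnegative.
\<close>
definition psd_mat :: "complex mat \<Rightarrow> bool" where
  "psd_mat A \<longleftrightarrow> hermitian_mat A \<and>
     (\<forall>v \<in> carrier_vec (dim_row A). 0 \<le> (A *\<^sub>v v) \<bullet>c v)"

text \<open>The matrix \<open>u u\<^sup>*\<close> of a vector \<open>u\<close>, read as a column.\<close>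
definition outer_mat :: "complex vec \<Rightarrow> complex mat" where
  "outer_mat u = (let U = mat_of_cols (dim_vec u) [u] in U * mat_adjoint U)"

definition rank_one_psd :: "nat \<Rightarrow> complex set \<Rightarrow> complex mat set" where
  "rank_one_psd N I =
     {A. \<exists>u \<in> carrier_vec N. A = outer_mat u \<and> vec_space.rank N A = 1 \<and>
         psd_mat A \<and> elements_mat A \<subseteq> I}"

text \<open>
  A function on \<open>I\<close> is represented by a total function; only its values on \<open>I\<close> matter,
  since the entries of the matrices involved lie in \<open>I\<close>.
\<close>
definition entrywise_preserves_psd_rank_one ::
    "nat \<Rightarrow> complex set \<Rightarrow> (complex \<Rightarrow> complex) \<Rightarrow> bool" where
  "entrywise_preserves_psd_rank_one N I f \<longleftrightarrow>
     (\<forall>A \<in> rank_one_psd N I. psd_mat (map_mat f A))"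

lemma outer_mat_carrier: "u \<in> carrier_vec N \<Longrightarrow> outer_mat u \<in> carrier_mat N N"
  by (auto simp: outer_mat_def Let_def mat_adjoint_def)

lemma outer_mat_index:
  "i < dim_vec u \<Longrightarrow> j < dim_vec u \<Longrightarrow> outer_mat u $$ (i, j) = u $ i * cnj (u $ j)"
  by (simp add: outer_mat_def Let_def mat_adjoint_def scalar_prod_def mat_of_cols_def
      mat_of_rows_def row_def col_def times_mat_def cols_def)

end

theory Submission
  imports Defs
begin

text \<open>
  For a polynomial \<open>f(z) = \<Sum>\<^sub>k c\<^sub>k z\<^sup>k\<close> and a column vector \<open>u\<close>, write \<open>u\<^sup>k\<close> for the
  entrywise power. Then
  \<open>f[u u\<^sup>*] = \<Sum>\<^sub>k c\<^sub>k u\<^sup>k (u\<^sup>k)\<^sup>*\<close>, so the quadratic form of \<open>f[u u\<^sup>*]\<close> at \<open>v\<close> is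
  \<open>\<Sum>\<^sub>k c\<^sub>k \<bar>\<langle>u\<^sup>k, v\<rangle>\<bar>\<^sup>2\<close> (lemma \<open>quadratic_form_power_outer_mat\<close>). If \<open>v\<close> is orthogonal to \<open>u\<^sup>k\<close> for each
  of the \<open>N\<close> exponents \<open>k = n\<^sub>j\<close> but not to \<open>u\<^sup>M\<close>, only the negative term with \<open>k = M\<close> survives,
  and positivity fails however large the other coefficients are (lemma \<open>not_psd_map_outer_mat\<close>).
  Such a \<open>v\<close> needs the \<open>N\<close> vectors \<open>u\<^sup>k\<close>, \<open>k = n\<^sub>j\<close>, to be linearly dependent, that is, a zero \<open>u\<close>
  of their generalized Vandermonde determinant. Over the positive reals there is none with
  distinct coordinates; over the complex numbers, roots of unity provide one.

  Let \<open>d\<close> be the difference of the largest and the smallest exponent. Since the \<open>N\<close> exponents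
  are not consecutive, \<open>d \<ge> N\<close> (lemma \<open>non_consecutive_gap\<close>). Let \<open>\<omega>\<close> be a primitive \<open>d\<close>-th
  root of unity and \<open>u\<^sub>i = r \<omega>\<^sup>i\<close> for \<open>i < N\<close>. Up to a factor \<open>r\<^sup>k\<close>, the pairing of \<open>u\<^sup>k\<close> with
  a coefficient vector \<open>q\<close> is the value of the polynomial \<open>q\<close> at \<open>\<omega>\<^sup>k\<close>. The extreme exponents
  give the same point, so the \<open>\<omega>\<^sup>k\<close> with \<open>k = n\<^sub>j\<close> form a set \<open>Z\<close> of at
  most \<open>N - 1\<close> points, and a polynomial of
  degree less than \<open>N\<close> vanishes exactly on \<open>Z\<close>. As there are \<open>d \<ge> N\<close> roots of unity of order
  dividing \<open>d\<close>, one of them, \<open>\<omega>\<^sup>m\<close>, lies outside \<open>Z\<close>, and \<open>M\<close> can be any large number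
  congruent to \<open>m\<close> modulo \<open>d\<close>. The scale \<open>r\<close> is free, which puts the entries of \<open>u u\<^sup>*\<close>
  into any given disc without affecting the choice of \<open>M\<close>.
\<close>

section \<open>Entrywise functions of rank-one matrices\<close>

lemma mat_adjoint_outer_mat: "mat_adjoint (outer_mat u) = outer_mat u"
proof -
  have c: "outer_mat u \<in> carrier_mat (dim_vec u) (dim_vec u)"
    by (rule outer_mat_carrier) simp
  show ?thesis
    using c
    by (intro eq_matI)
       (auto simp: mat_adjoint_def mat_of_rows_index cols_nth outer_mat_index mult.commute)
qed

lemma quadratic_form_map_outer_mat:
  assumes u: "u \<in> carrier_vec N" and v: "v \<in> carrier_vec N"
  shows "(map_mat f (outer_mat u) *\<^sub>v v) \<bullet>c v =
    (\<Sum>i<N. \<Sum>j<N. f (u $ i * cnj (u $ j)) * v $ j * cnj (v $ i))"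
proof -
  have c: "outer_mat u \<in> carrier_mat N N" by (rule outer_mat_carrier[OF u])
  show ?thesis
    using u v c
    by (auto simp: scalar_prod_def outer_mat_index sum_distrib_right atLeast0LessThan
          intro!: sum.cong)
qed

text \<open>
  The entrywise power of \<open>u u\<^sup>*\<close> is again of the form \<open>w w\<^sup>*\<close>, with \<open>w\<close> the entrywise power
  of \<open>u\<close>, so the double sum factors as a square.
\<close>
lemma quadratic_form_power_outer_mat:
  assumes u: "u \<in> carrier_vec N" and v: "v \<in> carrier_vec N"
  shows "(map_mat (\<lambda>z. z ^ k) (outer_mat u) *\<^sub>v v) \<bullet>c v =
    complex_of_real ((cmod (\<Sum>i<N. cnj (v $ i) * u $ i ^ k))\<^sup>2)"
proof -
  let ?S = "\<Sum>i<N. cnj (v $ i) * u $ i ^ k"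
  have "complex_of_real ((cmod ?S)\<^sup>2) = ?S * cnj ?S"
    by (rule complex_norm_square)
  also have "\<dots> = (\<Sum>i<N. \<Sum>j<N. (u $ i * cnj (u $ j)) ^ k * v $ j * cnj (v $ i))"
    unfolding cnj_sum sum_product
    by (intro sum.cong refl) (simp add: power_mult_distrib mult_ac)
  finally show ?thesis
    by (simp add: quadratic_form_map_outer_mat[OF u v])
qed

lemma psd_outer_mat: "psd_mat (outer_mat u)"
proof -
  have c: "outer_mat u \<in> carrier_mat (dim_vec u) (dim_vec u)"
    by (rule outer_mat_carrier) simp
  \<comment> \<open>The quadratic form of \<open>u u\<^sup>*\<close> itself is the case of exponent 1.\<close>
  have "map_mat (\<lambda>z. z ^ 1) (outer_mat u) = outer_mat u"
    by (intro eq_matI) auto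
  then have "0 \<le> (outer_mat u *\<^sub>v v) \<bullet>c v" if "v \<in> carrier_vec (dim_vec u)" for v
    using quadratic_form_power_outer_mat[of u "dim_vec u" v 1] that
    by (simp add: less_eq_complex_def del: of_real_power)
  then show ?thesis
    using c by (auto simp: psd_mat_def hermitian_mat_def mat_adjoint_outer_mat)
qed

lemma (in vec_space) lin_indpt_singleton:
  assumes w: "w \<in> carrier_vec n" and "w \<noteq> 0\<^sub>v n"
  shows "lin_indpt {w}"
proof
  assume "lin_dep {w}"
  then obtain a where a: "lincomb a {w} = 0\<^sub>v n" "a w \<noteq> 0"
    by (auto simp: lin_dep_def dest!: subset_singletonD)
  from a(1) w have "a w \<cdot>\<^sub>v w = 0\<^sub>v n"
    by (simp add: lincomb_def finsum_singleton)
  then have "inverse (a w) \<cdot>\<^sub>v (a w \<cdot>\<^sub>v w) = 0\<^sub>v n"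
    by simp
  with a(2) have "w = 0\<^sub>v n"
    by (simp add: smult_smult_assoc)
  with assms show False by simp
qed

lemma rank_outer_mat:
  assumes u: "u \<in> carrier_vec N" and i: "i < N" "u $ i \<noteq> 0"
  shows "vec_space.rank N (outer_mat u) = 1"
proof -
  interpret vec_space "TYPE(complex)" N .
  have c: "outer_mat u \<in> carrier_mat N N" by (rule outer_mat_carrier[OF u])
  have "rank (outer_mat u) \<le> 1"
    by (rule rank_le_1_product_entries[OF c, where f = "\<lambda>i. u $ i" and g = "\<lambda>j. cnj (u $ j)"])
       (use u c in \<open>auto simp: outer_mat_index\<close>)
  moreover have "card {col (outer_mat u) i} \<le> rank (outer_mat u)"
  proof (rule rank_ge_card_indpt[OF c])
    show "{col (outer_mat u) i} \<subseteq> set (cols (outer_mat u))"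
      using c i by (auto simp: cols_def)
    have "col (outer_mat u) i $ i \<noteq> 0"
      using c u i by (simp add: outer_mat_index)
    then have "col (outer_mat u) i \<noteq> 0\<^sub>v N"
      using i by force
    then show "lin_indpt {col (outer_mat u) i}"
      using c i by (intro lin_indpt_singleton) auto
  qed
  ultimately show ?thesis by simp
qed

lemma outer_mat_in_rank_one_psd:
  assumes u: "u \<in> carrier_vec N" and "N > 0"
    and r: "\<And>i. i < N \<Longrightarrow> cmod (u $ i) = r" and "r > 0" "r\<^sup>2 < \<rho>"
  shows "outer_mat u \<in> rank_one_psd N {z. cmod z < \<rho>}"
proof -
  have c: "outer_mat u \<in> carrier_mat N N" by (rule outer_mat_carrier[OF u])
  have "u $ 0 \<noteq> 0" using r[of 0] \<open>N > 0\<close> \<open>r > 0\<close> by fastforce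
  then have "vec_space.rank N (outer_mat u) = 1"
    using rank_outer_mat[OF u] \<open>N > 0\<close> by blast
  moreover have "elements_mat (outer_mat u) \<subseteq> {z. cmod z < \<rho>}"
    using c u r \<open>r\<^sup>2 < \<rho>\<close>
    by (auto dest!: elements_matD simp: outer_mat_index norm_mult power2_eq_square)
  ultimately show ?thesis
    using u psd_outer_mat by (auto simp: rank_one_psd_def)
qed

text \<open>
  The quadratic form is linear in the entrywise function, so a vector \<open>v\<close> that annihilates all the
  monomials except \<open>z\<^sup>M\<close> sees only the sign of the coefficient of \<open>z\<^sup>M\<close>.
\<close>
lemma not_psd_map_outer_mat:
  assumes u: "u \<in> carrier_vec N" and v: "v \<in> carrier_vec N"
    and zero: "\<And>j. j \<in> J \<Longrightarrow> (\<Sum>i<N. cnj (v $ i) * u $ i ^ n j) = 0"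
    and nz: "(\<Sum>i<N. cnj (v $ i) * u $ i ^ M) \<noteq> 0"
    and "a < 0"
  shows "\<not> psd_mat (map_mat (\<lambda>z. (\<Sum>j\<in>J. b j * z ^ n j) + complex_of_real a * z ^ M) (outer_mat u))"
proof
  let ?Q = "\<lambda>f. (map_mat f (outer_mat u) *\<^sub>v v) \<bullet>c v"
  let ?f = "\<lambda>z. (\<Sum>j\<in>J. b j * z ^ n j) + complex_of_real a * z ^ M"
  have c: "outer_mat u \<in> carrier_mat N N" by (rule outer_mat_carrier[OF u])
  have split: "?Q ?f = (\<Sum>j\<in>J. b j * ?Q (\<lambda>z. z ^ n j)) + complex_of_real a * ?Q (\<lambda>z. z ^ M)"
    unfolding quadratic_form_map_outer_mat[OF u v]
    by (simp add: sum_distrib_left sum_distrib_right sum.distrib distrib_right mult.assoc sum.swap[of _ _ J])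
  have "?Q ?f = complex_of_real (a * (cmod (\<Sum>i<N. cnj (v $ i) * u $ i ^ M))\<^sup>2)"
    unfolding split quadratic_form_power_outer_mat[OF u v] using zero
    by simp
  moreover have "a * (cmod (\<Sum>i<N. cnj (v $ i) * u $ i ^ M))\<^sup>2 < 0"
    using nz \<open>a < 0\<close> by (simp add: mult_neg_pos)
  moreover assume "psd_mat (map_mat ?f (outer_mat u))"
  then have "0 \<le> ?Q ?f"
    using v c by (auto simp: psd_mat_def)
  ultimately show False
    by (simp add: less_eq_complex_def del: of_real_mult of_real_power)
qed

section \<open>Exponents and roots of unity\<close>

text \<open>
  An increasing sequence of integers gains at least 1 at each step. A term off the line
  \<open>n 0 + j\<close> thus lies above it, and this excess persists up to the last term.
\<close>
lemma non_consecutive_gap: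
  fixes n :: "nat \<Rightarrow> nat"
  assumes mono: "strict_mono_on {..<N} n" and "N > 0"
    and gap: "\<not> (\<exists>h. \<forall>j<N. n j = h + j)"
  shows "n 0 + N \<le> n (N - 1)"
proof -
  have step: "n i + k \<le> n (i + k)" if "i + k < N" for i k
    using that
  proof (induction k)
    case (Suc k)
    then have "n (i + k) < n (i + Suc k)"
      by (intro strict_mono_onD[OF mono]) auto
    with Suc show ?case by simp
  qed simp
  obtain j where j: "j < N" "n j \<noteq> n 0 + j"
    using gap by metis
  have "n 0 + j < n j" using step[of 0 j] j by simp
  moreover have "n j + (N - 1 - j) \<le> n (N - 1)"
    using step[of j "N - 1 - j"] j by simp
  ultimately show ?thesis using j(1) by simp
qed

text \<open>
  The coefficients of \<open>\<Prod>\<^sub>z (x - z)\<close>, padded with zeros to length \<open>N\<close>. They form a vector orthogonal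
  to the Vandermonde vectors \<open>(x\<^sup>i)\<close>, \<open>i < N\<close>, with node \<open>x\<close> in \<open>Z\<close> and to no others.
\<close>
lemma obtain_vanishing_coeffs:
  fixes Z :: "'a :: field set"
  assumes "finite Z" "card Z < N"
  obtains q where "\<And>x. (\<Sum>i<N. coeff q i * x ^ i) = 0 \<longleftrightarrow> x \<in> Z"
proof
  define q where "q = (\<Prod>z\<in>Z. [:- z, 1:])"
  have "degree q \<le> card Z"
    using degree_prod_sum_le[OF \<open>finite Z\<close>, of "\<lambda>z. [:- z, 1:]"] by (simp add: q_def)
  then have "poly q x = (\<Sum>i<N. coeff q i * x ^ i)" for x
    unfolding poly_altdef using \<open>card Z < N\<close>
    by (intro sum.mono_neutral_left) (auto simp: coeff_eq_0)
  moreover have "poly q x = 0 \<longleftrightarrow> x \<in> Z" for x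
    using \<open>finite Z\<close> by (auto simp: q_def poly_prod)
  ultimately show "(\<Sum>i<N. coeff q i * x ^ i) = 0 \<longleftrightarrow> x \<in> Z" for x
    by metis
qed

theorem proposition7p1:
  fixes N :: nat and n :: "nat \<Rightarrow> nat"
  assumes "N \<ge> 2"
    and "strict_mono_on {..<N} n"
    and "\<not> (\<exists>h::nat. \<forall>j<N. n j = h + j)"
  shows "\<exists>M::nat. M > n (N - 1) \<and>
    (\<forall>c :: nat \<Rightarrow> real. (\<forall>j<N. c (n j) > 0) \<and> c M < 0 \<longrightarrow>
      (\<forall>\<rho>::real. \<rho> > 0 \<longrightarrow>
        \<not> entrywise_preserves_psd_rank_one N {z :: complex. cmod z < \<rho>}
            (\<lambda>z. (\<Sum>j<N. complex_of_real (c (n j)) * z ^ n j) + complex_of_real (c M) * z ^ M)))"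
proof -
  define d where "d = n (N - 1) - n 0"
  define \<omega> where "\<omega> = cis (2 * pi / real d)"
  have gap: "n 0 + N \<le> n (N - 1)"
    using non_consecutive_gap assms by simp
  then have d: "d \<ge> N" "d > 0" "n (N - 1) = n 0 + d"
    using \<open>N \<ge> 2\<close> by (auto simp: d_def)
  have \<omega>_d: "\<omega> ^ d = 1"
    using d by (simp add: \<omega>_def DeMoivre)
  have norm_\<omega>: "cmod \<omega> = 1"
    by (simp add: \<omega>_def)
  have \<omega>_last: "\<omega> ^ n (N - 1) = \<omega> ^ n 0"
    unfolding d(3) by (simp add: power_add \<omega>_d)

  define Z where "Z = (\<lambda>j. \<omega> ^ n j) ` {..<N - 1}"
  have "finite Z" by (simp add: Z_def)
  have card_Z: "card Z < N"
    using card_image_le[of "{..<N - 1}" "\<lambda>j. \<omega> ^ n j"] \<open>N \<ge> 2\<close> by (simp add: Z_def)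
  have in_Z: "\<omega> ^ n j \<in> Z" if "j < N" for j
  proof (cases "j = N - 1")
    case True
    then show ?thesis using \<omega>_last \<open>N \<ge> 2\<close> by (auto simp: Z_def)
  next
    case False
    then show ?thesis using that by (auto simp: Z_def)
  qed

  have "\<exists>m. \<omega> ^ m \<notin> Z"
  proof (rule ccontr)
    assume "\<not> ?thesis"
    then have "(\<lambda>k. cis (2 * pi * real k / real d)) ` {..<d} \<subseteq> Z"
      by (auto simp: \<omega>_def DeMoivre mult_ac)
    then have "{z. z ^ d = 1} \<subseteq> Z"
      using bij_betw_roots_unity[OF \<open>d > 0\<close>] by (simp add: bij_betw_def)
    then have "d \<le> card Z"
      using card_mono[OF \<open>finite Z\<close>] card_roots_unity_eq[OF \<open>d > 0\<close>] by metis
    with card_Z d show False by simp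
  qed
  then obtain m where m: "\<omega> ^ m \<notin> Z" ..
  \<comment> \<open>Adding a multiple of \<open>d\<close> makes \<open>M\<close> large and keeps \<open>\<omega>\<^sup>M = \<omega>\<^sup>m\<close>.\<close>
  define M where "M = m + d * Suc (n (N - 1))"
  have M_notin: "\<omega> ^ M \<notin> Z"
    using m by (simp only: M_def power_add power_mult \<omega>_d power_one mult_1_right not_False_eq_True)
  have "n (N - 1) < d * Suc (n (N - 1))"
    using d(2) by (cases d) auto
  then have M_gt: "M > n (N - 1)"
    by (simp add: M_def)

  obtain q where q: "\<And>x. (\<Sum>i<N. coeff q i * x ^ i) = 0 \<longleftrightarrow> x \<in> Z"
    using obtain_vanishing_coeffs[OF \<open>finite Z\<close> card_Z] by blast
  \<comment> \<open>The conjugates cancel those in the inner product, which leaves the value of the polynomial.\<close>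
  define v where "v = vec N (\<lambda>i. cnj (coeff q i))"
  have v: "v \<in> carrier_vec N" by (simp add: v_def)

  show ?thesis
  proof (intro exI[of _ M] conjI M_gt allI impI, elim conjE)
    fix c :: "nat \<Rightarrow> real" and \<rho> :: real
    assume cM: "c M < 0" and "\<rho> > 0"
    \<comment> \<open>Every entry of \<open>u u\<^sup>*\<close> will have absolute value \<open>r\<^sup>2 = \<rho> / 2\<close>.\<close>
    define r where "r = sqrt (\<rho> / 2)"
    have r: "r > 0" "r\<^sup>2 < \<rho>" using \<open>\<rho> > 0\<close> by (auto simp: r_def)
    define u where "u = vec N (\<lambda>i. complex_of_real r * \<omega> ^ i)"
    have u: "u \<in> carrier_vec N" by (simp add: u_def)
    have "(\<Sum>i<N. cnj (v $ i) * u $ i ^ k) = complex_of_real r ^ k * (\<Sum>i<N. coeff q i * (\<omega> ^ k) ^ i)" for k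
      by (simp add: u_def v_def sum_distrib_left power_mult_distrib mult_ac flip: power_mult)
    then have moment: "(\<Sum>i<N. cnj (v $ i) * u $ i ^ k) = 0 \<longleftrightarrow> \<omega> ^ k \<in> Z" for k
      using q r by simp
    have "outer_mat u \<in> rank_one_psd N {z. cmod z < \<rho>}"
      using r \<open>N \<ge> 2\<close> norm_\<omega>
      by (intro outer_mat_in_rank_one_psd[OF u, of r]) (auto simp: u_def norm_mult norm_power)
    moreover have "\<not> psd_mat (map_mat (\<lambda>z. (\<Sum>j<N. complex_of_real (c (n j)) * z ^ n j)
        + complex_of_real (c M) * z ^ M) (outer_mat u))"
      using moment in_Z M_notin
      by (intro not_psd_map_outer_mat[OF u v _ _ cM]) auto
    ultimately show "\<not> entrywise_preserves_psd_rank_one N {z. cmod z < \<rho>}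
        (\<lambda>z. (\<Sum>j<N. complex_of_real (c (n j)) * z ^ n j) + complex_of_real (c M) * z ^ M)"
      unfolding entrywise_preserves_psd_rank_one_def by blast
  qed
qed

end
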